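(* Let $K\subseteq\mathbb{R}$ be a compact set of positive Lebesgue measure. The composition $$(L^\infty(K),\|\cdot\|_{\mathrm A})\xrightarrow{\;J_K\;}(X_K,\|\cdot\|_\infty)\xrightarrow{\;\Psi_K\;}(C_0([0,|K|]),\|\cdot\|_\infty)$$ is a linear isometric embedding whose range is $\mathrm{Lip}_0([0,|K|])$. Furthermore, for every $f\in L^\infty(K)$, $$\frac{d}{dt}\,\Psi_K(J_K(f))(t)=f(\sigma_K(t))\quad\text{for a.e. }t\in[0,|K|].$$
   Context: $\lambda$ denotes Lebesgue measure and $|K|=\lambda(K)$. $L^\infty(K)$ is the space of (a.e. classes of) real-valued essentially bounded measurable functions on $K$. For $f\in L^\infty(K)$, $J_Kf(x)=\int_{[\min K,x]\cap K}f\,d\lambda$ for $x\in K$, and $\|f\|_{\mathrm A}=\sup_{x\in K}|J_Kf(x)|$ (Alexiewicz norm). The measure projection is $\pi_K:K\to[0,|K|]$, $\pi_K(x)=\lambda([\min K,x]\cap K)$, which is Lipschitz, nondecreasing and surjective, and $\sigma_K:[0,|K|]\to K$ is $\sigma_K(t)=\min\pi_K^{-1}(t)$. $C_0([0,a])$ is the space of real-valued continuous functions on $[0,a]$ vanishing at $0$, and $\mathrm{Lip}_0([0,a])$ is its subspace of Lipschitz functions, both with the supremum norm. $X_K$ is the space of all $F\in C(K)$ (real-valued) with $F(\min K)=0$ and such that $F|_{\pi_K^{-1}(t)}$ is constant for each $t\in[0,|K|]$, with the supremum norm; $J_Kf\in X_K$ for all $f\in L^\infty(K)$. The map $\Psi_K:X_K\to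 C_0([0,|K|])$ is $\Psi_KF(t)=F(\sigma_K(t))$, $t\in[0,|K|]$. *)

theory Defs
  imports "HOL-Analysis.Analysis"
begin

text \<open>
  The spaces below depend on the set \<open>K\<close>, so they are carrier sets with explicit operations.
  The classes of functions are considered up to equality almost everywhere; a continuous function
  on \<open>S\<close> is an element of \<open>extensional S\<close>, so that equality is equality on \<open>S\<close>.
\<close>

record 'a normed_struct =
  carrier :: "'a set"
  add :: "'a \<Rightarrow> 'a \<Rightarrow> 'a"
  scale :: "real \<Rightarrow> 'a \<Rightarrow> 'a"
  nrm :: "'a \<Rightarrow> real"

definition linear_isometric_embedding ::
  "'a normed_struct \<Rightarrow> 'b normed_struct \<Rightarrow> ('a \<Rightarrow> 'b) \<Rightarrow> bool" where
  "linear_isometric_embedding V W T \<longleftrightarrow>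
     T \<in> carrier V \<rightarrow> carrier W \<and>
     (\<forall>u\<in>carrier V. \<forall>v\<in>carrier V. T (add V u v) = add W (T u) (T v)) \<and>
     (\<forall>c. \<forall>u\<in>carrier V. T (scale V c u) = scale W c (T u)) \<and>
     (\<forall>u\<in>carrier V. nrm W (T u) = nrm V u) \<and>
     inj_on T (carrier V)"

definition sup_norm :: "real set \<Rightarrow> (real \<Rightarrow> real) \<Rightarrow> real" where
  "sup_norm S F = (SUP x\<in>S. \<bar>F x\<bar>)"

definition fun_space :: "real set \<Rightarrow> (real \<Rightarrow> real) set \<Rightarrow> (real \<Rightarrow> real) normed_struct" where
  "fun_space S V =
     \<lparr> carrier = V,
       add = (\<lambda>F G. \<lambda>x\<in>S. F x + G x),
       scale = (\<lambda>c F. \<lambda>x\<in>S. c * F x),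
       nrm = sup_norm S \<rparr>"

definition set_min :: "real set \<Rightarrow> real" where
  "set_min S = (LEAST x. x \<in> S)"

definition vol :: "real set \<Rightarrow> real" where
  "vol K = measure lebesgue K"

definition mproj :: "real set \<Rightarrow> real \<Rightarrow> real" where
  "mproj K x = measure lebesgue ({set_min K..x} \<inter> K)"

definition msec :: "real set \<Rightarrow> real \<Rightarrow> real" where
  "msec K t = set_min {x \<in> K. mproj K x = t}"

text \<open>
  Values outside \<open>K\<close> of a representative of a class in \<open>L\<^sup>\<infinity>(K)\<close> are irrelevant to membership and
  to the equivalence relation, so representatives are total functions.
\<close>

definition Linf_fun :: "real set \<Rightarrow> (real \<Rightarrow> real) set" where
  "Linf_fun K = {f \<in> borel_measurable (lebesgue_on K). \<exists>C. AE x in lebesgue_on K. \<bar>f x\<bar> \<le> C}"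

definition ae_rel :: "real set \<Rightarrow> ((real \<Rightarrow> real) \<times> (real \<Rightarrow> real)) set" where
  "ae_rel K = {(f, g). f \<in> Linf_fun K \<and> g \<in> Linf_fun K \<and> (AE x in lebesgue_on K. f x = g x)}"

definition J_fun :: "real set \<Rightarrow> (real \<Rightarrow> real) \<Rightarrow> real \<Rightarrow> real" where
  "J_fun K f = (\<lambda>x\<in>K. LINT y:{set_min K..x} \<inter> K|lebesgue. f y)"

definition J_map :: "real set \<Rightarrow> (real \<Rightarrow> real) set \<Rightarrow> real \<Rightarrow> real" where
  "J_map K c = the_elem (J_fun K ` c)"

definition Linf_A :: "real set \<Rightarrow> (real \<Rightarrow> real) set normed_struct" where
  "Linf_A K =
     \<lparr> carrier = Linf_fun K // ae_rel K,
       add = (\<lambda>c d. \<Union>f\<in>c. \<Union>g\<in>d. ae_rel K `` {\<lambda>x. f x + g x}),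
       scale = (\<lambda>r c. \<Union>f\<in>c. ae_rel K `` {\<lambda>x. r * f x}),
       nrm = (\<lambda>c. SUP x\<in>K. \<bar>J_map K c x\<bar>) \<rparr>"

definition X_space :: "real set \<Rightarrow> (real \<Rightarrow> real) normed_struct" where
  "X_space K = fun_space K
     {F \<in> extensional K. continuous_on K F \<and> F (set_min K) = 0 \<and>
        (\<forall>t\<in>{0..vol K}. F constant_on {x \<in> K. mproj K x = t})}"

definition C0_space :: "real \<Rightarrow> (real \<Rightarrow> real) normed_struct" where
  "C0_space a = fun_space {0..a}
     {g \<in> extensional {0..a}. continuous_on {0..a} g \<and> g 0 = 0}"

definition Lip0 :: "real \<Rightarrow> (real \<Rightarrow> real) set" where
  "Lip0 a = {g \<in> carrier (C0_space a). \<exists>C. C-lipschitz_on {0..a} g}"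

definition Psi :: "real set \<Rightarrow> (real \<Rightarrow> real) \<Rightarrow> real \<Rightarrow> real" where
  "Psi K F = (\<lambda>t\<in>{0..vol K}. F (msec K t))"

lemma set_min_eq_Inf:
  assumes "compact S" "S \<noteq> {}"
  shows "set_min S \<in> S" "set_min S = Inf S"
proof -
  obtain m where m: "m \<in> S" "\<And>x. x \<in> S \<Longrightarrow> m \<le> x"
    using compact_attains_inf[OF assms] by blast
  have "set_min S = m"
    unfolding set_min_def using m by (intro Least_equality) auto
  moreover have "Inf S = m" using m by (intro cInf_eq_minimum) auto
  ultimately show "set_min S \<in> S" "set_min S = Inf S" using m by auto
qed

lemma equiv_ae_rel: "equiv (Linf_fun K) (ae_rel K)"
proof (rule equivI)
  show "ae_rel K \<subseteq> Linf_fun K \<times> Linf_fun K" by (auto simp: ae_rel_def)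
  show "refl_on (Linf_fun K) (ae_rel K)" by (auto simp: refl_on_def ae_rel_def)
  show "sym (ae_rel K)" by (auto simp: sym_def ae_rel_def elim: eventually_mono)
  show "trans (ae_rel K)"
    unfolding trans_def ae_rel_def by (auto elim: eventually_elim2)
qed

lemma Linf_fun_add:
  assumes "f \<in> Linf_fun K" "g \<in> Linf_fun K"
  shows "(\<lambda>x. f x + g x) \<in> Linf_fun K"
proof -
  obtain C D where C: "AE x in lebesgue_on K. \<bar>f x\<bar> \<le> C" and D: "AE x in lebesgue_on K. \<bar>g x\<bar> \<le> D"
    using assms by (auto simp: Linf_fun_def)
  have "AE x in lebesgue_on K. \<bar>f x + g x\<bar> \<le> C + D"
    using C D by eventually_elim auto
  then show ?thesis using assms by (auto simp: Linf_fun_def)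
qed

lemma Linf_fun_scale:
  assumes "f \<in> Linf_fun K"
  shows "(\<lambda>x. r * f x) \<in> Linf_fun K"
proof -
  obtain C where C: "AE x in lebesgue_on K. \<bar>f x\<bar> \<le> C"
    using assms by (auto simp: Linf_fun_def)
  have "AE x in lebesgue_on K. \<bar>r * f x\<bar> \<le> \<bar>r\<bar> * C"
    using C by eventually_elim (auto simp: abs_mult intro: mult_left_mono)
  then show ?thesis using assms by (auto simp: Linf_fun_def)
qed

lemma Linf_A_add_class:
  assumes "f \<in> Linf_fun K" "g \<in> Linf_fun K"
  shows "add (Linf_A K) (ae_rel K `` {f}) (ae_rel K `` {g}) = ae_rel K `` {\<lambda>x. f x + g x}"
proof -
  have "congruent2 (ae_rel K) (ae_rel K) (\<lambda>f g. ae_rel K `` {\<lambda>x. f x + g x})"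
  proof (rule congruent2I')
    fix f f' g g' assume *: "(f, f') \<in> ae_rel K" "(g, g') \<in> ae_rel K"
    have "AE x in lebesgue_on K. f x + g x = f' x + g' x"
      using *[unfolded ae_rel_def, simplified] by (elim conjE) (erule (1) eventually_elim2, simp)
    with * have "(\<lambda>x. f x + g x, \<lambda>x. f' x + g' x) \<in> ae_rel K"
      by (auto simp: ae_rel_def Linf_fun_add)
    then show "ae_rel K `` {\<lambda>x. f x + g x} = ae_rel K `` {\<lambda>x. f' x + g' x}"
      by (rule equiv_class_eq[OF equiv_ae_rel])
  qed
  from UN_equiv_class2[OF equiv_ae_rel equiv_ae_rel this assms] show ?thesis
    by (simp add: Linf_A_def)
qed

lemma Linf_A_scale_class:
  assumes "f \<in> Linf_fun K"
  shows "scale (Linf_A K) r (ae_rel K `` {f}) = ae_rel K `` {\<lambda>x. r * f x}"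
proof -
  have "congruent (ae_rel K) (\<lambda>f. ae_rel K `` {\<lambda>x. r * f x})"
  proof (rule congruentI)
    fix f f' assume *: "(f, f') \<in> ae_rel K"
    have "AE x in lebesgue_on K. r * f x = r * f' x"
      using *[unfolded ae_rel_def, simplified] by (elim conjE) (erule eventually_mono, simp)
    with * have "(\<lambda>x. r * f x, \<lambda>x. r * f' x) \<in> ae_rel K"
      by (auto simp: ae_rel_def Linf_fun_scale)
    then show "ae_rel K `` {\<lambda>x. r * f x} = ae_rel K `` {\<lambda>x. r * f' x}"
      by (rule equiv_class_eq[OF equiv_ae_rel])
  qed
  from UN_equiv_class[OF equiv_ae_rel this assms] show ?thesis
    by (simp add: Linf_A_def)
qed

lemma J_map_class:
  assumes K: "compact K" and f: "f \<in> Linf_fun K"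
  shows "J_map K (ae_rel K `` {f}) = J_fun K f"
proof -
  have [measurable]: "K \<in> sets lebesgue" using K by (simp add: lmeasurable_compact fmeasurableD)
  have "J_fun K g = J_fun K f" if g: "g \<in> ae_rel K `` {f}" for g
  proof -
    from g have fg: "AE x in lebesgue. x \<in> K \<longrightarrow> f x = g x" and gL: "g \<in> Linf_fun K"
      by (auto simp: ae_rel_def AE_restrict_space_iff)
    have "(LINT y:{set_min K..x} \<inter> K|lebesgue. g y) = (LINT y:{set_min K..x} \<inter> K|lebesgue. f y)" for x
    proof -
      have m: "(\<lambda>y. indicator ({set_min K..x} \<inter> K) y *\<^sub>R h y) \<in> borel_measurable lebesgue"
        if "h \<in> Linf_fun K" for h :: "real \<Rightarrow> real"
      proof -
        have "(\<lambda>y. indicator K y *\<^sub>R h y) \<in> borel_measurable lebesgue"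
        proof -
          have "h \<in> borel_measurable (lebesgue_on K)" using that by (simp add: Linf_fun_def)
          then show ?thesis by (subst (asm) borel_measurable_restrict_space_iff) auto
        qed
        then have "(\<lambda>y. indicator {set_min K..x} y *\<^sub>R (indicator K y *\<^sub>R h y)) \<in> borel_measurable lebesgue"
          by (rule borel_measurable_scaleR[rotated]) (rule borel_measurable_indicator, simp)
        then show ?thesis by (simp add: indicator_inter_arith mult.assoc)
      qed
      show ?thesis unfolding set_lebesgue_integral_def
        using fg by (intro integral_cong_AE m gL f) (auto elim!: eventually_mono simp: indicator_def)
    qed
    then show ?thesis by (simp add: J_fun_def)
  qed
  moreover have "f \<in> ae_rel K `` {f}" using f by (auto simp: ae_rel_def)
  ultimately have "J_fun K ` (ae_rel K `` {f}) = {J_fun K f}" by blast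
  then show ?thesis by (simp add: J_map_def)
qed

end

theory Submission
  imports Defs "HOL-Probability.Distribution_Functions"
begin

text \<open>
  Write \<open>p\<close> for the measure projection of \<open>K\<close>, \<open>\<sigma>\<close> for its section \<open>msec\<close>, and \<open>G f\<close> for the primitive
  \<open>x \<mapsto> \<integral>\<^bsub>[min K, x] \<inter> K\<^esub> f\<close>, taken at every real \<open>x\<close> and not only on \<open>K\<close>. For \<open>x \<le> y\<close> the increment
  of \<open>G f\<close> is the integral of \<open>f\<close> over \<open>(x, y] \<inter> K\<close>, and the increment of \<open>p\<close> is the measure of that
  same set. Hence an essential bound \<open>C\<close> of \<open>f\<close> gives \<open>\<bar>G f y - G f x\<bar> \<le> C \<bar>p y - p x\<bar>\<close>
  (\<open>primitive_on_bound\<close>). So \<open>G f\<close> is constant on the fibres of \<open>p\<close> and factors as \<open>g \<circ> p\<close> with a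
  Lipschitz function \<open>g\<close> on \<open>[0, |K|]\<close>, which is \<open>\<Psi> (J f)\<close>. As \<open>p\<close> maps \<open>K\<close> onto \<open>[0, |K|]\<close>, the
  functions \<open>J f\<close> and \<open>g\<close> take the same values, and the map is isometric.

  The derivative comes from the Lebesgue differentiation theorem for \<open>f 1\<^sub>K\<close> and for \<open>1\<^sub>K\<close>: at almost every
  \<open>x \<in> K\<close>, \<open>G f\<close> has derivative \<open>f x\<close> and \<open>p\<close> has derivative \<open>1\<close>. At such an \<open>x\<close> the monotone function \<open>p\<close>
  is strictly increasing, so \<open>x\<close> is alone in its fibre and \<open>\<sigma>\<close> is continuous at \<open>p x\<close>; the quotient of
  the two difference quotients then shows that \<open>g\<close> has derivative \<open>f x\<close> at \<open>p x\<close>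
  (\<open>Psi_J_fun_derivative_at_density_point\<close>). The exceptional points form a null set, and the Lipschitz
  function \<open>p\<close> maps it to a null set. Differentiating \<open>G f\<close> also recovers \<open>f\<close> almost everywhere from
  \<open>g\<close>, which is injectivity on classes.

  For the range, let \<open>g\<close> be \<open>C\<close>-Lipschitz with \<open>g 0 = 0\<close>. The increments of \<open>g \<circ> p\<close> over \<open>(x, y]\<close> are at most
  \<open>C\<close> times the measure of \<open>(x, y] \<inter> K\<close>, so the Radon-Nikodym theorem writes them as integrals over
  \<open>(x, y] \<inter> K\<close> of a function bounded by \<open>C\<close> (\<open>dominated_increments_have_density\<close>); this function is the
  preimage of \<open>g\<close>.
\<close>

section \<open>Differentiation of indefinite integrals on the line\<close>

text \<open>
  The averages of an integrable function over the boxes with lower corner \<open>x\<close> and shrinking side converge to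
  its value at \<open>x\<close> for almost every \<open>x\<close>; on the line these averages are right difference quotients.
\<close>
lemma indefinite_integral_one_sided:
  fixes f G :: "real \<Rightarrow> real"
  assumes "\<And>x y. x \<le> y \<Longrightarrow> (f has_integral (G y - G x)) {x..y}"
  obtains N where "negligible N"
    "\<And>x. x \<notin> N \<Longrightarrow> (G has_real_derivative f x) (at_right x)"
proof -
  have "f integrable_on cbox a b" for a b
    using assms[of a b] by (cases "a \<le> b") (auto simp: integrable_on_def)
  then obtain N where N: "negligible N"
    "\<And>x e. \<lbrakk>x \<notin> N; 0 < e\<rbrakk> \<Longrightarrow>
       \<exists>d>0. \<forall>h. 0 < h \<and> h < d \<longrightarrow>
         norm (integral (cbox x (x + h *\<^sub>R One)) f /\<^sub>R h ^ DIM(real) - f x) < e"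
    using integrable_ccontinuous_explicit by metis
  have "(G has_real_derivative f x) (at_right x)" if x: "x \<notin> N" for x
    unfolding has_field_derivative_iff tendsto_iff dist_real_def
  proof (intro allI impI)
    fix e :: real assume "0 < e"
    then obtain d where "d > 0" and
      d: "\<And>h. 0 < h \<and> h < d \<Longrightarrow> \<bar>integral {x..x + h} f / h - f x\<bar> < e"
      using N(2)[OF x, of e] by (auto simp: divide_inverse_commute)
    have "\<bar>(G y - G x) / (y - x) - f x\<bar> < e" if "x < y" "y < x + d" for y
      using d[of "y - x"] that integral_unique[OF assms[of x y]] by auto
    then show "\<forall>\<^sub>F y in at_right x. \<bar>(G y - G x) / (y - x) - f x\<bar> < e"
      unfolding eventually_at_right_field using \<open>d > 0\<close> by (intro exI[of _ "x + d"]) auto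
  qed
  with N(1) show ?thesis using that by blast
qed

text \<open>
  The left derivative is the right derivative of the reflected primitive \<open>x \<mapsto> - G (- x)\<close>.
\<close>
lemma indefinite_integral_derivative_AE:
  fixes f G :: "real \<Rightarrow> real"
  assumes "\<And>x y. x \<le> y \<Longrightarrow> (f has_integral (G y - G x)) {x..y}"
  obtains N where "negligible N"
    "\<And>x. x \<notin> N \<Longrightarrow> (G has_real_derivative f x) (at x)"
proof -
  obtain N1 where N1: "negligible N1"
    "\<And>x. x \<notin> N1 \<Longrightarrow> (G has_real_derivative f x) (at_right x)"
    using indefinite_integral_one_sided[OF assms] by blast
  have refl: "((\<lambda>x. f (- x)) has_integral (- G (- y) - (- G (- x)))) {x..y}" if "x \<le> y" for x y
    using assms[of "- y" "- x"] that
      has_integral_reflect_real[where f=f and i="G (- x) - G (- y)" and a="- y" and b="- x"]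
    by simp
  obtain N2 where N2: "negligible N2"
    "\<And>x. x \<notin> N2 \<Longrightarrow> ((\<lambda>x. - G (- x)) has_real_derivative f (- x)) (at_right x)"
    using indefinite_integral_one_sided[OF refl] by blast
  have "(G has_real_derivative f x) (at x)" if "x \<notin> N1 \<union> uminus ` N2" for x
  proof -
    have "- x \<notin> N2" using that by force
    then have "((\<lambda>y. (- G (- y) - - G x) / (y - - x)) \<longlongrightarrow> f x) (at_right (- x))"
      using N2(2)[of "- x"] by (simp add: has_field_derivative_iff)
    then have "((\<lambda>y. (- G y + G x) / (- y + x)) \<longlongrightarrow> f x) (at_left x)"
      by (subst filterlim_at_left_to_right) simp
    moreover have "(- G y + G x) / (- y + x) = (G y - G x) / (y - x)" for y
      using minus_divide_divide[of "G y - G x" "y - x"] by simp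
    ultimately have "((\<lambda>y. (G y - G x) / (y - x)) \<longlongrightarrow> f x) (at_left x)"
      by simp
    moreover have "((\<lambda>y. (G y - G x) / (y - x)) \<longlongrightarrow> f x) (at_right x)"
      using N1(2)[of x] that by (simp add: has_field_derivative_iff)
    ultimately show ?thesis
      by (simp add: has_field_derivative_iff filterlim_split_at)
  qed
  moreover have "negligible (N1 \<union> uminus ` N2)"
    using N1(1) N2(1)
    by (auto intro!: negligible_differentiable_image_negligible derivative_intros
      simp: differentiable_on_def)
  ultimately show ?thesis using that by blast
qed

section \<open>Functions whose increments are dominated by a measure\<close>

lemma emeasure_add_measure:
  assumes "sets N = sets M" "A \<in> sets M"
  shows "emeasure (measure_of (space M) (sets M) (\<lambda>A. emeasure M A + emeasure N A)) A
       = emeasure M A + emeasure N A"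
proof (rule emeasure_measure_of_sigma)
  show "countably_additive (sets M) (\<lambda>A. emeasure M A + emeasure N A)"
    using assms(1)
    by (auto simp: countably_additive_def suminf_add[OF summableI summableI, symmetric] suminf_emeasure)
qed (use assms in \<open>auto simp: positive_def sets.sigma_algebra_axioms\<close>)

text \<open>
  Let \<open>P\<close> be the distribution function of \<open>M\<close>. The functions \<open>L P + F\<close> and \<open>L P - F\<close> are
  nondecreasing and right-continuous, so both define Stieltjes measures, and these add up to \<open>2 L M\<close>. Therefore
  the first one has a density \<open>\<phi>\<close> with \<open>0 \<le> \<phi> \<le> 2 L\<close>, and \<open>\<phi> - L\<close> is a density for the increments of \<open>F\<close>.
\<close>
lemma dominated_increments_have_density:
  fixes M :: "real measure" and F :: "real \<Rightarrow> real"
  assumes fin: "finite_measure M" and M[measurable_cong]: "sets M = sets borel"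
    and L: "0 \<le> L" and F: "\<And>x y. x \<le> y \<Longrightarrow> \<bar>F y - F x\<bar> \<le> L * measure M {x<..y}"
  obtains f where "f \<in> borel_measurable borel" "\<And>x. \<bar>f x\<bar> \<le> L"
    "\<And>x y. x \<le> y \<Longrightarrow> F y - F x = (LINT z:{x<..y}|M. f z)"
proof -
  interpret finite_borel_measure M
    using fin M by (simp add: finite_borel_measure_def finite_borel_measure_axioms_def)
  have P: "cdf M y - cdf M x = measure M {x<..y}" if "x \<le> y" for x y
    using that cdf_diff_eq[of x y] by (cases "x = y") auto
  have F_cont: "continuous (at_right a) F" for a
    unfolding continuous_within
  proof (rule LIM_zero_cancel, rule Lim_null_comparison)
    show "((\<lambda>y. L * (cdf M y - cdf M a)) \<longlongrightarrow> 0) (at_right a)"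
      using cdf_is_right_cont[of a] unfolding continuous_within
      by (intro tendsto_mult_right_zero LIM_zero)
    show "\<forall>\<^sub>F y in at_right a. norm (F y - F a) \<le> L * (cdf M y - cdf M a)"
      by (rule eventually_at_right_less[THEN eventually_mono]) (use F P in auto)
  qed
  \<comment> \<open>The sign \<open>s\<close> is \<open>1\<close> or \<open>-1\<close>, for the two Stieltjes measures.\<close>
  define G where "G s x = L * cdf M x + s * F x" for s x :: real
  have G_mono: "G s x \<le> G s y" and G_cont: "continuous (at_right a) (G s)"
    if "s \<in> {-1, 1}" "x \<le> y" for s x y a
  proof -
    show "G s x \<le> G s y"
      using that F[of x y] P[of x y] by (auto simp: G_def algebra_simps)
    show "continuous (at_right a) (G s)"
      unfolding G_def by (intro continuous_intros cdf_is_right_cont F_cont)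
  qed
  define N where "N s = interval_measure (G s)" for s
  have sets_N[measurable_cong, simp]: "sets (N s) = sets borel" for s by (simp add: N_def)
  have N: "emeasure (N s) {x<..y} = ennreal (G s y - G s x)" if "s \<in> {-1, 1}" "x \<le> y" for s x y
    unfolding N_def using that by (intro emeasure_interval_measure_Ioc G_mono G_cont) auto
  define S where "S = measure_of UNIV (sets borel) (\<lambda>A. emeasure (N 1) A + emeasure (N (-1)) A)"
  have S: "emeasure S A = emeasure (N 1) A + emeasure (N (-1)) A" if "A \<in> sets borel" for A
    using emeasure_add_measure[of "N (-1)" "N 1" A] that
    by (simp add: S_def N_def)
  \<comment> \<open>Both sides agree on half-open intervals, where the contributions of \<open>F\<close> cancel.\<close>
  have S_eq: "S = density M (\<lambda>_. ennreal (2 * L))"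
  proof (rule measure_eqI_generator_eq)
    let ?E = "range (\<lambda>(a, b). {a<..b::real})"
    show "Int_stable ?E"
      by (auto simp: Int_stable_def Int_greaterThanAtMost)
    show "sets S = sigma_sets UNIV ?E" "sets (density M (\<lambda>_. ennreal (2 * L))) = sigma_sets UNIV ?E"
      by (simp_all add: S_def M borel_sigma_sets_Ioc sigma_sets_sigma_sets_eq)
    show "emeasure S X = emeasure (density M (\<lambda>_. ennreal (2 * L))) X" if X_in: "X \<in> ?E" for X
    proof -
      obtain a b where X: "X = {a<..b}" using X_in by auto
      show ?thesis
      proof (cases "a \<le> b")
        case True
        then have "emeasure S X = ennreal (G 1 b - G 1 a + (G (-1) b - G (-1) a))"
          unfolding X using G_mono[of 1 a b] G_mono[of "-1" a b]
          by (subst ennreal_plus) (auto simp: S N)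
        also have "\<dots> = ennreal (2 * L * measure M X)"
          using P[OF True] by (simp add: G_def X algebra_simps)
        also have "\<dots> = emeasure (density M (\<lambda>_. ennreal (2 * L))) X"
          using L by (simp add: emeasure_density_const X emeasure_eq_measure ennreal_mult M)
        finally show ?thesis .
      qed (auto simp: X)
    qed
    show "range (\<lambda>n. {- real n<..real n}) \<subseteq> ?E" by auto
    show "emeasure S {- real n<..real n} \<noteq> \<infinity>" for n
      by (simp add: S N)
  qed (auto simp: UN_Ioc_eq_UNIV)
  have N_le: "emeasure (N s) A \<le> ennreal (2 * L) * emeasure M A" if "s \<in> {-1, 1}" "A \<in> sets borel" for s A
    using S[OF that(2)] that by (auto simp: S_eq emeasure_density_const M)
  have "\<exists>\<phi>\<in>borel_measurable M. density M \<phi> = N s" if "s \<in> {-1, 1}" for s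
  proof (rule Radon_Nikodym)
    show "absolutely_continuous M (N s)"
      unfolding absolutely_continuous_def
    proof
      fix A assume "A \<in> null_sets M"
      then show "A \<in> null_sets (N s)"
        using N_le[OF that, of A] by (auto simp: null_sets_def M)
    qed
  qed (simp add: M)
  then obtain \<phi> where \<phi>[measurable]: "\<And>s. s \<in> {-1, 1} \<Longrightarrow> \<phi> s \<in> borel_measurable M"
    and dens: "\<And>s. s \<in> {-1, 1} \<Longrightarrow> density M (\<phi> s) = N s" by metis
  have [measurable]: "\<phi> 1 \<in> borel_measurable M" "\<phi> (-1) \<in> borel_measurable M" using \<phi> by auto
  have "density M (\<lambda>x. \<phi> 1 x + \<phi> (-1) x) = density M (\<lambda>_. ennreal (2 * L))"
  proof (rule measure_eqI)
    fix A assume "A \<in> sets (density M (\<lambda>x. \<phi> 1 x + \<phi> (-1) x))"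
    then have A[measurable]: "A \<in> sets M" by simp
    have "emeasure (density M (\<lambda>x. \<phi> 1 x + \<phi> (-1) x)) A =
      emeasure (density M (\<phi> 1)) A + emeasure (density M (\<phi> (-1))) A"
      by (simp add: emeasure_density distrib_right nn_integral_add)
    also have "\<dots> = emeasure S A" using A by (simp add: dens S M)
    finally show "emeasure (density M (\<lambda>x. \<phi> 1 x + \<phi> (-1) x)) A = emeasure (density M (\<lambda>_. ennreal (2 * L))) A"
      by (simp add: S_eq)
  qed simp
  then have sum: "AE x in M. \<phi> 1 x + \<phi> (-1) x = ennreal (2 * L)"
    by (subst (asm) density_unique_iff) auto
  have bd: "AE x in M. \<phi> 1 x \<le> ennreal (2 * L)"
    using sum by eventually_elim (metis add_increasing2 order_refl zero_le)
  \<comment> \<open>The bound on \<open>\<phi>\<close> holds almost everywhere; truncation makes the bound on \<open>f\<close> hold everywhere.\<close>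
  define f where "f x = max (- L) (min L (enn2real (\<phi> 1 x) - L))" for x
  have f_meas[measurable]: "f \<in> borel_measurable borel"
    using \<open>\<phi> 1 \<in> borel_measurable M\<close> unfolding f_def measurable_cong_sets[OF M refl] by measurable
  have f_eq: "AE x in M. f x = enn2real (\<phi> 1 x) - L"
    using bd
  proof eventually_elim
    case (elim x)
    then have "enn2real (\<phi> 1 x) \<le> 2 * L" using L by (intro enn2real_leI) auto
    then show ?case using enn2real_nonneg[of "\<phi> 1 x"] by (simp add: f_def)
  qed
  have f_le: "\<bar>f x\<bar> \<le> L" for x
    unfolding f_def max_def min_def using L enn2real_nonneg[of "\<phi> 1 x"]
    by (auto simp: abs_le_iff)
  show ?thesis
  proof (rule that[OF f_meas f_le])
    fix x y :: real assume xy: "x \<le> y"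
    have int: "set_integrable M {x<..y} f"
      unfolding set_integrable_def
      by (rule integrable_const_bound[where B=L]) (use L f_le in \<open>auto simp: indicator_def\<close>)
    have c: "(LINT z:{x<..y}|M. L) = L * measure M {x<..y}"
      by (subst set_integral_const) (auto simp: emeasure_eq_measure M)
    have ci: "set_integrable M {x<..y} (\<lambda>_. L)"
      unfolding set_integrable_def
      by (rule integrable_const_bound[where B=L]) (use L in \<open>auto simp: indicator_def\<close>)
    have "(LINT z:{x<..y}|M. f z) + L * measure M {x<..y} = (LINT z:{x<..y}|M. f z + L)"
      using set_integral_add(2)[OF int ci] c by simp
    also have "\<dots> = (LINT z|M. enn2real (\<phi> 1 z * indicator {x<..y} z))"
      unfolding set_lebesgue_integral_def
      by (rule integral_cong_AE) (use f_eq in \<open>auto elim!: eventually_mono simp: indicator_def enn2real_mult\<close>)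
    also have "\<dots> = enn2real (\<integral>\<^sup>+z. \<phi> 1 z * indicator {x<..y} z \<partial>M)"
    proof (subst integral_eq_nn_integral)
      show "enn2real (\<integral>\<^sup>+z. ennreal (enn2real (\<phi> 1 z * indicator {x<..y} z)) \<partial>M) = 
        enn2real (\<integral>\<^sup>+z. \<phi> 1 z * indicator {x<..y} z \<partial>M)"
        using bd by (intro arg_cong[where f=enn2real] nn_integral_cong_AE)
          (auto elim!: eventually_mono simp: indicator_def ennreal_enn2real_if top_unique)
    qed auto
    also have "\<dots> = enn2real (emeasure (N 1) {x<..y})"
      by (subst dens[symmetric]) (auto simp: emeasure_density M)
    also have "\<dots> = G 1 y - G 1 x" using N[of 1 x y] G_mono[of 1 x y] xy by simp
    also have "\<dots> = F y - F x + L * measure M {x<..y}"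
      using P[OF xy] by (simp add: G_def algebra_simps)
    finally show "F y - F x = (LINT z:{x<..y}|M. f z)" by simp
  qed
qed

section \<open>The primitive and the measure projection on the whole line\<close>

text \<open>
  The formula that defines \<open>J_fun\<close>, read at all reals: two-sided derivatives and reals outside \<open>K\<close> are then
  available. Its case \<open>f = 1\<close> is the measure projection.
\<close>
definition primitive_on :: "real set \<Rightarrow> (real \<Rightarrow> real) \<Rightarrow> real \<Rightarrow> real" where
  "primitive_on K f x = (LINT y:{set_min K..x} \<inter> K|lebesgue. f y)"

context
  fixes K :: "real set"
  assumes compact_K: "compact K" and vol_pos: "0 < vol K"
begin

lemma K_lmeasurable: "K \<in> lmeasurable"
  using compact_K by (rule lmeasurable_compact)

lemma K_sets [measurable]: "K \<in> sets lebesgue"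
  using K_lmeasurable by (rule fmeasurableD)

lemma K_nonempty: "K \<noteq> {}"
  using vol_pos by (auto simp: vol_def)

lemma set_min_in: "set_min K \<in> K"
  using set_min_eq_Inf(1)[OF compact_K K_nonempty] .

lemma set_min_le: "x \<in> K \<Longrightarrow> set_min K \<le> x"
  using set_min_eq_Inf(2)[OF compact_K K_nonempty]
  by (simp add: cInf_lower compact_imp_bounded bounded_imp_bdd_below compact_K)

lemma AE_lebesgue_on_K: "(AE x in lebesgue_on K. P x) \<longleftrightarrow> (AE x in lebesgue. x \<in> K \<longrightarrow> P x)"
  by (subst AE_restrict_space_iff) auto

lemma Linf_set_integrable:
  assumes f: "f \<in> Linf_fun K"
  shows "set_integrable lebesgue K f"
proof -
  obtain C where "AE x in lebesgue_on K. \<bar>f x\<bar> \<le> C" and "f \<in> borel_measurable (lebesgue_on K)"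
    using f by (auto simp: Linf_fun_def)
  then have "integrable (lebesgue_on K) f"
    using finite_measure_lebesgue_on[OF K_lmeasurable]
    by (intro finite_measure.integrable_const_bound[where B=C]) auto
  then show ?thesis
    by (simp add: integrable_restrict_space set_integrable_def)
qed

lemma Linf_const: "(\<lambda>_. c) \<in> Linf_fun K"
  by (auto simp: Linf_fun_def)

text \<open>
  The lower limit \<open>min K\<close> of integration leaves no trace even when \<open>x\<close> lies below it, because \<open>K\<close> has no
  points there.
\<close>
lemma primitive_on_diff:
  assumes f: "f \<in> Linf_fun K" and "x \<le> y"
  shows "primitive_on K f y - primitive_on K f x = (LINT z:{x<..y} \<inter> K|lebesgue. f z)"
proof -
  have "{set_min K..y} \<inter> K = ({set_min K..x} \<inter> K) \<union> ({x<..y} \<inter> K)"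
    using \<open>x \<le> y\<close> set_min_le by force
  then have "primitive_on K f y = primitive_on K f x + (LINT z:{x<..y} \<inter> K|lebesgue. f z)"
    unfolding primitive_on_def
    by (simp only:) (rule set_integral_Un; (rule set_integrable_subset[OF Linf_set_integrable[OF f]])?; auto)
  then show ?thesis by simp
qed

lemma primitive_on_has_integral:
  assumes f: "f \<in> Linf_fun K" and "x \<le> y"
  shows "((\<lambda>z. if z \<in> K then f z else 0) has_integral
           (primitive_on K f y - primitive_on K f x)) {x..y}"
proof -
  have "set_integrable lebesgue ({x<..y} \<inter> K) f"
    by (rule set_integrable_subset[OF Linf_set_integrable[OF f]]) auto
  from has_integral_set_lebesgue[OF this]
  have "(f has_integral (primitive_on K f y - primitive_on K f x)) ({x<..y} \<inter> K)"
    using primitive_on_diff[OF assms] by simp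
  then have "((\<lambda>z. if z \<in> K then f z else 0) has_integral
      (primitive_on K f y - primitive_on K f x)) {x<..y}"
    using has_integral_restrict_Int[of K f _ "{x<..y}"] by (simp add: Int_commute)
  then show ?thesis
    by (subst (asm) has_integral_spike_set_eq[of _ "{x..y}"])
       (auto intro: negligible_subset[OF negligible_sing[of x]])
qed

lemma primitive_on_mono:
  assumes f: "f \<in> Linf_fun K" and g: "g \<in> Linf_fun K"
    and le: "AE x in lebesgue_on K. f x \<le> g x" and "x \<le> y"
  shows "primitive_on K f y - primitive_on K f x \<le> primitive_on K g y - primitive_on K g x"
proof -
  have *: "set_integrable lebesgue ({x<..y} \<inter> K) h" if "h \<in> Linf_fun K" for h
    by (rule set_integrable_subset[OF Linf_set_integrable[OF that]]) auto
  show ?thesis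
    unfolding primitive_on_diff[OF f \<open>x \<le> y\<close>] primitive_on_diff[OF g \<open>x \<le> y\<close>]
      set_lebesgue_integral_def
    using *[OF f] *[OF g] le
    by (intro integral_mono_AE)
       (auto simp: set_integrable_def AE_lebesgue_on_K indicator_def elim!: eventually_mono)
qed

lemma primitive_on_const: "primitive_on K (\<lambda>_. c) x = c * mproj K x"
  unfolding primitive_on_def mproj_def
  using K_lmeasurable fmeasurable_Int_fmeasurable[of K lebesgue "{set_min K..x}"]
  by (subst set_integral_const) (auto simp: fmeasurable_def Int_commute)

lemma mproj_diff:
  assumes "x \<le> y"
  shows "mproj K y - mproj K x = measure lebesgue ({x<..y} \<inter> K)"
proof -
  have "{x<..y} \<inter> K \<in> lmeasurable"
    using K_lmeasurable by (intro fmeasurable_Int_fmeasurable[of K lebesgue "{x<..y}", unfolded Int_commute[of K]]) auto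
  then show ?thesis
    using primitive_on_diff[OF Linf_const[of 1] assms] unfolding primitive_on_const
    by (subst (asm) set_integral_const) (auto simp: fmeasurable_def)
qed

lemma mproj_mono: "x \<le> y \<Longrightarrow> mproj K x \<le> mproj K y"
  using mproj_diff[of x y] measure_nonneg[of lebesgue "{x<..y} \<inter> K"] by linarith

lemma mproj_less_imp_less: "mproj K x < mproj K y \<Longrightarrow> x < y"
  using mproj_mono[of y x] by linarith

lemma mproj_lipschitz: "\<bar>mproj K y - mproj K x\<bar> \<le> \<bar>y - x\<bar>"
proof -
  have *: "mproj K v - mproj K u \<le> v - u" if "u \<le> v" for u v
  proof -
    have "measure lebesgue ({u<..v} \<inter> K) \<le> measure lebesgue {u<..v}"
      using that by (intro measure_mono_fmeasurable) (auto simp: fmeasurable_def)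
    then show ?thesis using that mproj_diff[OF that] by simp
  qed
  show ?thesis
    using *[of x y] *[of y x] mproj_mono[of x y] mproj_mono[of y x]
    by (cases "x \<le> y") auto
qed

lemma mproj_continuous: "continuous_on S (mproj K)"
proof -
  have "1-lipschitz_on S (mproj K)"
    by (intro lipschitz_onI) (auto simp: dist_real_def mproj_lipschitz)
  then show ?thesis by (rule lipschitz_on_continuous_on)
qed

lemma mproj_below: "x \<le> set_min K \<Longrightarrow> mproj K x = 0"
  unfolding mproj_def
  by (intro negligible_imp_measure0 negligible_subset[OF negligible_sing[of "set_min K"]]) auto

lemma mproj_above:
  assumes "\<And>y. y \<in> K \<Longrightarrow> y \<le> x"
  shows "mproj K x = vol K"
proof -
  have "{set_min K..x} \<inter> K = K" using assms set_min_le by auto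
  then show ?thesis by (simp add: mproj_def vol_def)
qed

lemma mproj_range: "mproj K x \<in> {0..vol K}"
proof -
  have "measure lebesgue ({set_min K..x} \<inter> K) \<le> measure lebesgue K"
    by (rule measure_mono_fmeasurable) (auto simp: K_lmeasurable)
  then show ?thesis by (simp add: mproj_def vol_def)
qed

text \<open>
  The intermediate value theorem yields a real preimage \<open>x\<close>, possibly in a gap of \<open>K\<close>; moving down to the last
  point of \<open>K\<close> below \<open>x\<close> crosses no point of \<open>K\<close> and keeps the value.
\<close>
lemma mproj_surj:
  assumes "t \<in> {0..vol K}"
  obtains u where "u \<in> K" "mproj K u = t"
proof -
  obtain b where b: "b \<in> K" "\<And>y. y \<in> K \<Longrightarrow> y \<le> b"
    using compact_attains_sup[OF compact_K K_nonempty] by blast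
  have "\<exists>x. set_min K \<le> x \<and> x \<le> b \<and> mproj K x = t"
    using assms mproj_below[of "set_min K"] mproj_above[OF b(2)] set_min_le[OF b(1)]
    by (intro IVT') (auto intro: mproj_continuous)
  then obtain x where x: "set_min K \<le> x" "mproj K x = t" by blast
  have "compact (K \<inter> {..x})" "K \<inter> {..x} \<noteq> {}"
    using compact_K x(1) set_min_in by (auto intro: compact_Int_closed)
  then obtain u where u: "u \<in> K" "u \<le> x" "\<And>y. y \<in> K \<Longrightarrow> y \<le> x \<Longrightarrow> y \<le> u"
    using compact_attains_sup[of "K \<inter> {..x}"] by auto
  then have "{u<..x} \<inter> K = {}" by force
  then have "mproj K u = mproj K x" using mproj_diff[OF u(2)] by simp
  with u(1) x(2) that show ?thesis by blast
qed

lemma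
  assumes t: "t \<in> {0..vol K}"
  shows msec_in: "msec K t \<in> K" and mproj_msec: "mproj K (msec K t) = t"
    and msec_le: "\<And>x. x \<in> K \<Longrightarrow> mproj K x = t \<Longrightarrow> msec K t \<le> x"
proof -
  let ?S = "{x \<in> K. mproj K x = t}"
  have "?S = K \<inter> mproj K -` {t}" by auto
  moreover have "closed (mproj K -` {t})"
    using mproj_continuous[of UNIV] by (intro closed_vimage) auto
  ultimately have S: "compact ?S" "?S \<noteq> {}"
    using compact_K mproj_surj[OF t] by (auto intro: compact_Int_closed)
  note set_min_eq_Inf[OF S]
  moreover have "Inf ?S \<le> x" if "x \<in> ?S" for x
    using that S(1) by (intro cInf_lower) (auto simp: compact_imp_bounded bounded_imp_bdd_below)
  ultimately show "msec K t \<in> K" "mproj K (msec K t) = t"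
    "\<And>x. x \<in> K \<Longrightarrow> mproj K x = t \<Longrightarrow> msec K t \<le> x"
    unfolding msec_def by auto
qed

text \<open>
  Comparing \<open>f\<close> with the constants \<open>C\<close> and \<open>- C\<close>, whose primitives are multiples of the measure projection, gives
  the estimate on which the factorisation through the projection rests.
\<close>
lemma primitive_on_bound:
  assumes f: "f \<in> Linf_fun K" and C: "AE x in lebesgue_on K. \<bar>f x\<bar> \<le> C"
  shows "\<bar>primitive_on K f y - primitive_on K f x\<bar> \<le> C * \<bar>mproj K y - mproj K x\<bar>"
proof -
  have "AE x in lebesgue_on K. f x \<le> C" "AE x in lebesgue_on K. - C \<le> f x"
    using C by (auto elim!: eventually_mono)
  then have *: "\<bar>primitive_on K f v - primitive_on K f u\<bar> \<le> C * (mproj K v - mproj K u)" if "u \<le> v" for u v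
    using primitive_on_mono[OF f Linf_const[of C] _ that] primitive_on_mono[OF Linf_const[of "- C"] f _ that]
    by (simp add: primitive_on_const algebra_simps abs_le_iff)
  show ?thesis
  proof (cases "x \<le> y")
    case True
    then show ?thesis using *[OF True] mproj_mono[OF True] by simp
  next
    case False
    then show ?thesis using *[of y x] mproj_mono[of y x] by (simp add: abs_minus_commute)
  qed
qed

lemma primitive_on_fibre:
  assumes f: "f \<in> Linf_fun K" and "mproj K x = mproj K y"
  shows "primitive_on K f x = primitive_on K f y"
proof -
  obtain C where "AE x in lebesgue_on K. \<bar>f x\<bar> \<le> C" using f by (auto simp: Linf_fun_def)
  from primitive_on_bound[OF f this, of x y] show ?thesis using assms(2) by simp
qed

section \<open>Passing from \<open>K\<close> to the interval \<open>[0, |K|]\<close>\<close>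

lemma J_fun_eq: "J_fun K f = restrict (primitive_on K f) K"
  by (simp add: J_fun_def primitive_on_def[abs_def])

lemma Psi_J_fun:
  assumes "t \<in> {0..vol K}"
  shows "Psi K (J_fun K f) t = primitive_on K f (msec K t)"
  using assms msec_in[OF assms] by (simp add: Psi_def J_fun_eq)

text \<open>
  The point \<open>x\<close> is any real number: it shares its value of the projection with a point of \<open>K\<close>, and the primitive
  does not distinguish the two.
\<close>
lemma Psi_J_fun_mproj:
  assumes "f \<in> Linf_fun K"
  shows "Psi K (J_fun K f) (mproj K x) = primitive_on K f x"
  using Psi_J_fun[OF mproj_range] primitive_on_fibre[OF assms mproj_msec[OF mproj_range]] by simp

lemma Psi_J_fun_lipschitz:
  assumes f: "f \<in> Linf_fun K"
  shows "\<exists>C. C-lipschitz_on {0..vol K} (Psi K (J_fun K f))"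
proof -
  obtain C where C: "AE x in lebesgue_on K. \<bar>f x\<bar> \<le> C" using f by (auto simp: Linf_fun_def)
  then have C': "AE x in lebesgue_on K. \<bar>f x\<bar> \<le> max C 0" by (auto elim!: eventually_mono)
  have "(max C 0)-lipschitz_on {0..vol K} (Psi K (J_fun K f))"
  proof (rule lipschitz_onI)
    fix s t assume "s \<in> {0..vol K}" "t \<in> {0..vol K}"
    then show "dist (Psi K (J_fun K f) s) (Psi K (J_fun K f) t) \<le> max C 0 * dist s t"
      using primitive_on_bound[OF f C', of "msec K s" "msec K t"]
      by (simp add: Psi_J_fun mproj_msec dist_real_def del: atLeastAtMost_iff)
  qed simp
  then show ?thesis by blast
qed

lemma J_fun_in_X:
  assumes f: "f \<in> Linf_fun K"
  shows "J_fun K f \<in> carrier (X_space K)"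
proof -
  obtain C where C: "C-lipschitz_on {0..vol K} (Psi K (J_fun K f))"
    using Psi_J_fun_lipschitz[OF f] by blast
  have "continuous_on K (\<lambda>x. Psi K (J_fun K f) (mproj K x))"
    using mproj_range
    by (intro continuous_on_compose2[OF lipschitz_on_continuous_on[OF C] mproj_continuous]) auto
  then have "continuous_on K (J_fun K f)"
    by (rule continuous_on_eq) (simp add: Psi_J_fun_mproj[OF f], simp add: J_fun_eq)
  moreover have "J_fun K f (set_min K) = 0"
  proof -
    \<comment> \<open>Left of the minimum the domain of integration is empty, and the projection is still \<open>0\<close>.\<close>
    have "primitive_on K f (set_min K) = primitive_on K f (set_min K - 1)"
      by (rule primitive_on_fibre[OF f]) (simp add: mproj_below)
    also have "\<dots> = 0" by (simp add: primitive_on_def set_lebesgue_integral_def)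
    finally show ?thesis by (simp add: J_fun_eq set_min_in)
  qed
  moreover have "J_fun K f constant_on {x \<in> K. mproj K x = t}" for t
  proof -
    have "\<exists>c. \<forall>x\<in>{x \<in> K. mproj K x = t}. J_fun K f x = c"
      by (rule exI[of _ "Psi K (J_fun K f) t"])
        (auto simp: J_fun_eq Psi_J_fun_mproj[OF f, unfolded J_fun_eq])
    then show ?thesis by (simp add: constant_on_def)
  qed
  ultimately show ?thesis
    by (simp add: X_space_def fun_space_def J_fun_eq)
qed

lemma X_space_factor:
  assumes F: "F \<in> carrier (X_space K)" and x: "x \<in> K"
  shows "Psi K F (mproj K x) = F x"
proof -
  have "F constant_on {y \<in> K. mproj K y = mproj K x}"
    using F mproj_range[of x] by (simp add: X_space_def fun_space_def)
  then obtain c where c: "\<And>y. y \<in> K \<Longrightarrow> mproj K y = mproj K x \<Longrightarrow> F y = c"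
    unfolding constant_on_def by blast
  then have "F (msec K (mproj K x)) = F x"
    using x msec_in[OF mproj_range] mproj_msec[OF mproj_range] by metis
  then show ?thesis using mproj_range[of x] by (simp add: Psi_def)
qed

lemma mproj_image: "mproj K ` K = {0..vol K}"
  using mproj_range mproj_surj by (auto simp del: atLeastAtMost_iff) (metis imageI)

text \<open>
  The section \<open>\<sigma>\<close> can jump. Continuity holds because \<open>\<Psi> F \<circ> p = F\<close> on \<open>K\<close>, so the preimage of a closed set under
  \<open>\<Psi> F\<close> is the image under \<open>p\<close> of a closed, hence compact, subset of \<open>K\<close>.
\<close>
lemma Psi_in_C0:
  assumes F: "F \<in> carrier (X_space K)"
  shows "Psi K F \<in> carrier (C0_space (vol K))"
proof -
  have FK: "continuous_on K F" "F (set_min K) = 0"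
    using F by (auto simp: X_space_def fun_space_def)
  have "continuous_on {0..vol K} (Psi K F)"
    unfolding continuous_on_closed_vimage[OF closed_real_atLeastAtMost]
  proof (intro allI impI)
    fix B :: "real set" assume "closed B"
    then have "closed (F -` B \<inter> K)"
      using FK(1) continuous_on_closed_vimage[OF compact_imp_closed[OF compact_K]] by blast
    then have "compact (mproj K ` (K \<inter> (F -` B \<inter> K)))"
      by (intro compact_continuous_image mproj_continuous compact_Int_closed compact_K)
    moreover have "Psi K F -` B \<inter> {0..vol K} = mproj K ` (K \<inter> (F -` B \<inter> K))"
      unfolding mproj_image[symmetric] using X_space_factor[OF F] by force
    ultimately show "closed (Psi K F -` B \<inter> {0..vol K})"
      by (simp add: compact_imp_closed)
  qed
  moreover have "Psi K F 0 = 0"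
    using X_space_factor[OF F set_min_in] FK(2) mproj_below[of "set_min K"] by simp
  ultimately show ?thesis
    by (simp add: C0_space_def fun_space_def Psi_def)
qed

lemma sup_norm_Psi:
  assumes F: "F \<in> carrier (X_space K)"
  shows "sup_norm {0..vol K} (Psi K F) = (SUP x\<in>K. \<bar>F x\<bar>)"
  unfolding sup_norm_def mproj_image[symmetric] image_image
  using X_space_factor[OF F] by simp

lemma primitive_on_add:
  assumes "f \<in> Linf_fun K" "g \<in> Linf_fun K"
  shows "primitive_on K (\<lambda>x. f x + g x) x = primitive_on K f x + primitive_on K g x"
  unfolding primitive_on_def
  by (intro set_integral_add(2) set_integrable_subset[OF Linf_set_integrable] assms) auto

lemma primitive_on_scale: "primitive_on K (\<lambda>x. c * f x) x = c * primitive_on K f x"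
  unfolding primitive_on_def by simp

section \<open>Derivatives at density points\<close>

text \<open>
  The indicator function of \<open>K\<close> has primitive \<open>p\<close>, so derivative \<open>1\<close> says that \<open>K\<close> has density one at \<open>x\<close>.
\<close>
lemma AE_density_point:
  assumes f: "f \<in> Linf_fun K"
  obtains N where "negligible N"
    "\<And>x. x \<in> K - N \<Longrightarrow> (primitive_on K f has_real_derivative f x) (at x)"
    "\<And>x. x \<in> K - N \<Longrightarrow> (mproj K has_real_derivative 1) (at x)"
proof -
  obtain N1 where N1: "negligible N1" "\<And>x. x \<notin> N1 \<Longrightarrow>
      (primitive_on K f has_real_derivative (if x \<in> K then f x else 0)) (at x)"
    using indefinite_integral_derivative_AE[OF primitive_on_has_integral[OF f]] by blast
  obtain N2 where N2: "negligible N2" "\<And>x. x \<notin> N2 \<Longrightarrow>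
      (primitive_on K (\<lambda>_. 1) has_real_derivative (if x \<in> K then 1 else 0)) (at x)"
    using indefinite_integral_derivative_AE[OF primitive_on_has_integral[OF Linf_const]] by blast
  have "primitive_on K (\<lambda>_. 1) = mproj K" by (simp add: primitive_on_const fun_eq_iff)
  then show ?thesis
    using N1 N2 by (intro that[of "N1 \<union> N2"]) (auto, (metis)+)
qed

text \<open>
  A positive derivative gives strict inequalities near \<open>x\<close>; monotonicity extends them to the whole line.
\<close>
lemma density_point_strict:
  assumes "(mproj K has_real_derivative 1) (at x)"
  shows "y < x \<Longrightarrow> mproj K y < mproj K x" and "x < y \<Longrightarrow> mproj K x < mproj K y"
proof -
  obtain d where d: "d > 0" "\<And>h. 0 < h \<Longrightarrow> h < d \<Longrightarrow> mproj K (x - h) < mproj K x"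
    using DERIV_pos_inc_left[OF assms] by auto
  obtain e where e: "e > 0" "\<And>h. 0 < h \<Longrightarrow> h < e \<Longrightarrow> mproj K x < mproj K (x + h)"
    using DERIV_pos_inc_right[OF assms] by auto
  show "mproj K y < mproj K x" if "y < x"
  proof -
    define h where "h = min (d / 2) (x - y)"
    have "0 < h" "h < d" "y \<le> x - h" using d(1) that by (auto simp: h_def)
    with d(2)[of h] mproj_mono[of y "x - h"] show ?thesis by linarith
  qed
  show "mproj K x < mproj K y" if "x < y"
  proof -
    define h where "h = min (e / 2) (y - x)"
    have "0 < h" "h < e" "x + h \<le> y" using e(1) that by (auto simp: h_def)
    with e(2)[of h] mproj_mono[of "x + h" y] show ?thesis by linarith
  qed
qed

lemma msec_at_density_point:
  assumes "x \<in> K" and der: "(mproj K has_real_derivative 1) (at x)"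
  shows "msec K (mproj K x) = x"
  using density_point_strict(1)[OF der, of "msec K (mproj K x)"]
    msec_le[OF mproj_range \<open>x \<in> K\<close> refl] mproj_msec[OF mproj_range, of x] by force

text \<open>
  For \<open>c < x\<close>, strictness gives \<open>p c < p x\<close>, so every \<open>s\<close> near \<open>p x\<close> exceeds \<open>p c\<close>, and a point with projection
  \<open>s\<close> must lie to the right of \<open>c\<close>; similarly for \<open>c > x\<close>.
\<close>
lemma msec_tendsto_density_point:
  assumes der: "(mproj K has_real_derivative 1) (at x)"
  shows "filterlim (msec K) (at x) (at (mproj K x) within {0..vol K})"
  unfolding filterlim_at
proof
  show "\<forall>\<^sub>F s in at (mproj K x) within {0..vol K}. msec K s \<in> UNIV \<and> msec K s \<noteq> x"
    unfolding eventually_at_filter using mproj_msec by (intro always_eventually) (auto simp del: atLeastAtMost_iff)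
  show "(msec K \<longlongrightarrow> x) (at (mproj K x) within {0..vol K})"
  proof (rule order_tendstoI)
    fix c assume "c < x"
    then have "\<forall>\<^sub>F s in at (mproj K x) within {0..vol K}. mproj K c < s"
      using density_point_strict(1)[OF der] order_tendstoD(1)[OF tendsto_ident_at] by blast
    then show "\<forall>\<^sub>F s in at (mproj K x) within {0..vol K}. c < msec K s"
      unfolding eventually_at_filter
      by (rule eventually_mono) (metis mproj_less_imp_less mproj_msec)
  next
    fix c assume "x < c"
    then have "\<forall>\<^sub>F s in at (mproj K x) within {0..vol K}. s < mproj K c"
      using density_point_strict(2)[OF der] order_tendstoD(2)[OF tendsto_ident_at] by blast
    then show "\<forall>\<^sub>F s in at (mproj K x) within {0..vol K}. msec K s < c"
      unfolding eventually_at_filter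
      by (rule eventually_mono) (metis mproj_less_imp_less mproj_msec)
  qed
qed

text \<open>
  The difference quotient of \<open>\<Psi> (J f)\<close> between \<open>p x\<close> and \<open>p y\<close> is the quotient of the difference quotients of
  the primitive and of \<open>p\<close> between \<open>x\<close> and \<open>y\<close>. Substituting \<open>y = \<sigma> s\<close> turns the limit \<open>y \<rightarrow> x\<close> into
  \<open>s \<rightarrow> p x\<close>.
\<close>
lemma Psi_J_fun_derivative_at_density_point:
  assumes f: "f \<in> Linf_fun K" and x: "x \<in> K"
    and dG: "(primitive_on K f has_real_derivative D) (at x)"
    and dp: "(mproj K has_real_derivative 1) (at x)"
  shows "(Psi K (J_fun K f) has_real_derivative D) (at (mproj K x) within {0..vol K})"
proof -
  let ?G = "primitive_on K f" and ?p = "mproj K"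
  have "((\<lambda>y. ((?G y - ?G x) / (y - x)) / ((?p y - ?p x) / (y - x))) \<longlongrightarrow> D / 1) (at x)"
    using dG dp unfolding has_field_derivative_iff by (intro tendsto_divide) auto
  moreover have "\<forall>\<^sub>F y in at x. ((?G y - ?G x) / (y - x)) / ((?p y - ?p x) / (y - x)) =
      (?G y - ?G x) / (?p y - ?p x)"
    by (auto simp: eventually_at_filter)
  ultimately have "((\<lambda>y. (?G y - ?G x) / (?p y - ?p x)) \<longlongrightarrow> D) (at x)"
    by (simp add: Lim_transform_eventually)
  from filterlim_compose[OF this msec_tendsto_density_point[OF dp]]
  have "((\<lambda>s. (?G (msec K s) - ?G x) / (?p (msec K s) - ?p x)) \<longlongrightarrow> D)
    (at (?p x) within {0..vol K})" .
  moreover have "\<forall>\<^sub>F s in at (?p x) within {0..vol K}.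
      (?G (msec K s) - ?G x) / (?p (msec K s) - ?p x) =
      (Psi K (J_fun K f) s - Psi K (J_fun K f) (?p x)) / (s - ?p x)"
    unfolding eventually_at_filter
    by (intro always_eventually)
      (simp add: Psi_J_fun mproj_msec Psi_J_fun_mproj[OF f] del: atLeastAtMost_iff)
  ultimately show ?thesis
    unfolding has_field_derivative_iff by (rule Lim_transform_eventually)
qed

lemma negligible_mproj_image:
  assumes "negligible N"
  shows "negligible (mproj K ` N)"
proof (rule negligible_locally_Lipschitz_image)
  show "\<exists>T B. open T \<and> x \<in> T \<and> (\<forall>y\<in>N \<inter> T. norm (mproj K y - mproj K x) \<le> B * norm (y - x))" for x
    by (rule exI[of _ UNIV], rule exI[of _ 1]) (simp add: mproj_lipschitz)
qed (use assms in auto)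

lemma Psi_J_fun_derivative_AE:
  assumes f: "f \<in> Linf_fun K"
  shows "AE t in lebesgue_on {0..vol K}.
    (Psi K (J_fun K f) has_real_derivative f (msec K t)) (at t within {0..vol K})"
proof -
  obtain N where N: "negligible N"
    "\<And>x. x \<in> K - N \<Longrightarrow> (primitive_on K f has_real_derivative f x) (at x)"
    "\<And>x. x \<in> K - N \<Longrightarrow> (mproj K has_real_derivative 1) (at x)"
    using AE_density_point[OF f] by blast
  have good: "(Psi K (J_fun K f) has_real_derivative f (msec K t)) (at t within {0..vol K})"
    if t: "t \<in> {0..vol K}" "t \<notin> mproj K ` N" for t
  proof -
    obtain x where x: "x \<in> K" "t = mproj K x" using mproj_surj[OF t(1)] by metis
    with t have "x \<in> K - N" by auto
    then show ?thesis
      using Psi_J_fun_derivative_at_density_point[OF f x(1)] N x msec_at_density_point by auto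
  qed
  have "AE t in lebesgue. t \<notin> mproj K ` N"
    using negligible_mproj_image[OF N(1)] by (auto simp: negligible_iff_null_sets intro: AE_not_in)
  then show ?thesis
    by (subst AE_restrict_space_iff) (auto elim!: eventually_mono intro: good)
qed

text \<open>
  Both primitives are \<open>g \<circ> p\<close> for the same \<open>g\<close>, so they agree on the whole line and have the same derivatives.
\<close>
lemma Psi_J_fun_eq_imp_AE_eq:
  assumes f: "f \<in> Linf_fun K" and g: "g \<in> Linf_fun K"
    and eq: "\<And>t. t \<in> {0..vol K} \<Longrightarrow> Psi K (J_fun K f) t = Psi K (J_fun K g) t"
  shows "AE x in lebesgue_on K. f x = g x"
proof -
  have same: "primitive_on K f = primitive_on K g"
  proof
    show "primitive_on K f x = primitive_on K g x" for x
      using eq[OF mproj_range[of x]] Psi_J_fun_mproj[OF f, of x] Psi_J_fun_mproj[OF g, of x]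
      by simp
  qed
  obtain N1 where N1: "negligible N1"
    "\<And>x. x \<in> K - N1 \<Longrightarrow> (primitive_on K f has_real_derivative f x) (at x)"
    "\<And>x. x \<in> K - N1 \<Longrightarrow> (mproj K has_real_derivative 1) (at x)"
    using AE_density_point[OF f] by blast
  obtain N2 where N2: "negligible N2"
    "\<And>x. x \<in> K - N2 \<Longrightarrow> (primitive_on K g has_real_derivative g x) (at x)"
    "\<And>x. x \<in> K - N2 \<Longrightarrow> (mproj K has_real_derivative 1) (at x)"
    using AE_density_point[OF g] by blast
  have "AE x in lebesgue. x \<notin> N1 \<union> N2"
    using N1(1) N2(1) by (intro AE_not_in) (auto simp: negligible_iff_null_sets)
  then show ?thesis
    unfolding AE_lebesgue_on_K
  proof eventually_elim
    case (elim x)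
    show ?case
    proof
      assume "x \<in> K"
      with elim show "f x = g x"
        using DERIV_unique[OF N1(2)[of x]] N2(2)[of x] same by simp
    qed
  qed
qed

section \<open>Every Lipschitz function is attained\<close>

lemma lipschitz_in_range_Psi_J_fun:
  assumes g: "C-lipschitz_on {0..vol K} g" "g 0 = 0"
  obtains f where "f \<in> Linf_fun K" "\<And>t. t \<in> {0..vol K} \<Longrightarrow> Psi K (J_fun K f) t = g t"
proof -
  define M where "M = density lborel (indicator K :: real \<Rightarrow> ennreal)"
  have K_borel[measurable]: "K \<in> sets borel" using compact_K by (simp add: compact_imp_closed)
  have M_emeasure: "emeasure M A = emeasure lborel (A \<inter> K)" if "A \<in> sets borel" for A
    unfolding M_def using that by (subst emeasure_restricted) (auto simp: Int_commute)
  have M_measure: "measure M A = measure lebesgue (A \<inter> K)" if "A \<in> sets borel" for A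
    using M_emeasure[OF that] that by (simp add: measure_def)
  have "emeasure lborel K < \<infinity>" using compact_K by (rule emeasure_compact_finite)
  then have "finite_measure M"
    by (intro finite_measureI) (simp add: M_emeasure M_def[THEN arg_cong[where f=space]] less_top)
  moreover have "\<bar>g (mproj K y) - g (mproj K x)\<bar> \<le> C * measure M {x<..y}" if "x \<le> y" for x y
    using lipschitz_onD[OF g(1) mproj_range mproj_range, of y x] mproj_diff[OF that] mproj_mono[OF that]
    by (simp add: dist_real_def M_measure)
  ultimately obtain f where f: "f \<in> borel_measurable borel" "\<And>x. \<bar>f x\<bar> \<le> C"
    "\<And>x y. x \<le> y \<Longrightarrow> g (mproj K y) - g (mproj K x) = (LINT z:{x<..y}|M. f z)"
    using dominated_increments_have_density[of M C "\<lambda>x. g (mproj K x)"] lipschitz_on_nonneg[OF g(1)]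
    by (auto simp: M_def)
  note [measurable] = f(1)
  have f_Linf: "f \<in> Linf_fun K"
    using f(1,2) by (auto simp: Linf_fun_def intro!: measurable_restrict_space1 measurable_completion exI[of _ C])
  have M_eq: "M = density lborel (\<lambda>x. ennreal (indicator K x))"
    by (simp add: M_def ennreal_indicator)
  have density: "(LINT z:A|M. f z) = (LINT z:A \<inter> K|lborel. f z)" if "A \<in> sets borel" for A
  proof -
    have "(LINT z:A|M. f z) = (LINT z|lborel. indicator K z *\<^sub>R (indicator A z *\<^sub>R f z))"
      unfolding set_lebesgue_integral_def M_eq using that by (intro integral_density) auto
    also have "\<dots> = (LINT z:A \<inter> K|lborel. f z)"
      unfolding set_lebesgue_integral_def
      by (rule Bochner_Integration.integral_cong) (auto simp: indicator_def)
    finally show ?thesis .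
  qed
  have "Psi K (J_fun K f) t = g t" if t: "t \<in> {0..vol K}" for t
  proof -
    obtain x where x: "x \<in> K" "mproj K x = t" using mproj_surj[OF t] .
    \<comment> \<open>The half-open interval starts at \<open>min K - 1\<close>, so that it contains \<open>min K\<close>.\<close>
    have le: "set_min K - 1 \<le> x" using set_min_le[OF x(1)] by simp
    have "g t = (LINT z:{set_min K - 1<..x}|M. f z)"
      using f(3)[OF le] x(2) g(2) by (simp add: mproj_below)
    also have "\<dots> = (LINT z:{set_min K - 1<..x} \<inter> K|lborel. f z)"
      by (rule density) simp
    also have "\<dots> = (LINT z:{set_min K - 1<..x} \<inter> K|lebesgue. f z)"
      unfolding set_lebesgue_integral_def by (rule integral_completion[symmetric]) measurable
    also have "{set_min K - 1<..x} \<inter> K = {set_min K..x} \<inter> K" using set_min_le by force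
    also have "(LINT z:{set_min K..x} \<inter> K|lebesgue. f z) = Psi K (J_fun K f) t"
      using Psi_J_fun_mproj[OF f_Linf, of x] x(2) by (simp add: primitive_on_def)
    finally show ?thesis by simp
  qed
  with f_Linf show ?thesis by (rule that)
qed

end

section \<open>The isometric embedding and its range\<close>

theorem proposition2p4:
  fixes K :: "real set"
  assumes "compact K" and "0 < vol K"
  shows
    "J_map K \<in> carrier (Linf_A K) \<rightarrow> carrier (X_space K) \<and>
     Psi K \<in> carrier (X_space K) \<rightarrow> carrier (C0_space (vol K)) \<and>
     linear_isometric_embedding (Linf_A K) (C0_space (vol K)) (Psi K \<circ> J_map K) \<and>
     (Psi K \<circ> J_map K) ` carrier (Linf_A K) = Lip0 (vol K) \<and>
     (\<forall>c \<in> carrier (Linf_A K). \<forall>f \<in> c.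
        AE t in lebesgue_on {0..vol K}.
          (Psi K (J_map K c) has_real_derivative f (msec K t)) (at t within {0..vol K}))"
proof -
  let ?T = "Psi K \<circ> J_map K" and ?cl = "\<lambda>f. ae_rel K `` {f}"
  note K = assms
  have carrier_Linf: "carrier (Linf_A K) = ?cl ` Linf_fun K"
    by (auto simp: Linf_A_def quotient_def)
  have J: "J_map K (?cl f) = J_fun K f" if "f \<in> Linf_fun K" for f
    using J_map_class[OF K(1) that] .
  have T: "Psi K (J_map K (?cl f)) = (\<lambda>t\<in>{0..vol K}. primitive_on K f (msec K t))" if "f \<in> Linf_fun K" for f
    using Psi_J_fun[OF K, of _ f] that by (simp add: J Psi_def fun_eq_iff del: atLeastAtMost_iff)
  have J_X: "J_map K \<in> carrier (Linf_A K) \<rightarrow> carrier (X_space K)"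
    by (auto simp: carrier_Linf J J_fun_in_X[OF K])
  have Psi_C0: "Psi K \<in> carrier (X_space K) \<rightarrow> carrier (C0_space (vol K))"
    using Psi_in_C0[OF K] by blast
  have lie: "linear_isometric_embedding (Linf_A K) (C0_space (vol K)) ?T"
    unfolding linear_isometric_embedding_def
  proof (intro conjI allI ballI)
    show "?T \<in> carrier (Linf_A K) \<rightarrow> carrier (C0_space (vol K))"
      using J_X Psi_C0 by auto
    show "?T (add (Linf_A K) u v) = add (C0_space (vol K)) (?T u) (?T v)"
      if uv: "u \<in> carrier (Linf_A K)" "v \<in> carrier (Linf_A K)" for u v
    proof -
      obtain f g where "f \<in> Linf_fun K" "u = ?cl f" "g \<in> Linf_fun K" "v = ?cl g"
        using uv by (auto simp: carrier_Linf)
      then show ?thesis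
        by (simp add: Linf_A_add_class Linf_fun_add T primitive_on_add[OF K] C0_space_def
            fun_space_def cong: restrict_cong)
    qed
    show "?T (scale (Linf_A K) c u) = scale (C0_space (vol K)) c (?T u)"
      if u: "u \<in> carrier (Linf_A K)" for c u
    proof -
      obtain f where "f \<in> Linf_fun K" "u = ?cl f"
        using u by (auto simp: carrier_Linf)
      then show ?thesis
        by (simp add: Linf_A_scale_class Linf_fun_scale T primitive_on_scale[OF K] C0_space_def
            fun_space_def cong: restrict_cong)
    qed
    show "nrm (C0_space (vol K)) (?T u) = nrm (Linf_A K) u" if "u \<in> carrier (Linf_A K)" for u
      using sup_norm_Psi[OF K, of "J_map K u"] J_X that
      by (auto simp: C0_space_def fun_space_def Linf_A_def Pi_iff)
    show "inj_on ?T (carrier (Linf_A K))"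
    proof (rule inj_onI)
      fix u v assume uv: "u \<in> carrier (Linf_A K)" "v \<in> carrier (Linf_A K)" "?T u = ?T v"
      then obtain f g where fg: "f \<in> Linf_fun K" "u = ?cl f" "g \<in> Linf_fun K" "v = ?cl g"
        by (auto simp: carrier_Linf)
      then have "AE x in lebesgue_on K. f x = g x"
        using uv(3) by (intro Psi_J_fun_eq_imp_AE_eq[OF K]) (auto simp: J)
      with fg have "(f, g) \<in> ae_rel K" by (simp add: ae_rel_def)
      then show "u = v" unfolding fg by (rule equiv_class_eq[OF equiv_ae_rel])
    qed
  qed
  have range: "?T ` carrier (Linf_A K) = Lip0 (vol K)"
  proof (intro equalityI subsetI)
    fix g assume "g \<in> ?T ` carrier (Linf_A K)"
    then obtain f where f: "f \<in> Linf_fun K" "g = Psi K (J_fun K f)"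
      by (auto simp: carrier_Linf J)
    then show "g \<in> Lip0 (vol K)"
      using Psi_in_C0[OF K J_fun_in_X[OF K f(1)]] Psi_J_fun_lipschitz[OF K f(1)]
      by (simp add: Lip0_def)
  next
    fix g assume "g \<in> Lip0 (vol K)"
    then obtain C where g: "C-lipschitz_on {0..vol K} g" "g 0 = 0" "g \<in> extensional {0..vol K}"
      by (auto simp: Lip0_def C0_space_def fun_space_def)
    obtain f where f: "f \<in> Linf_fun K" "\<And>t. t \<in> {0..vol K} \<Longrightarrow> Psi K (J_fun K f) t = g t"
      using lipschitz_in_range_Psi_J_fun[OF K g(1,2)] by blast
    have "Psi K (J_fun K f) = g"
      by (rule extensionalityI[OF _ g(3) f(2)]) (simp_all add: Psi_def extensional_def)
    then have "g = ?T (?cl f)" by (simp add: J f(1))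
    then show "g \<in> ?T ` carrier (Linf_A K)"
      by (rule image_eqI) (simp add: carrier_Linf f(1))
  qed
  have deriv: "AE t in lebesgue_on {0..vol K}.
      (Psi K (J_map K c) has_real_derivative f (msec K t)) (at t within {0..vol K})"
    if "c \<in> carrier (Linf_A K)" "f \<in> c" for c f
  proof -
    from that obtain h where h: "h \<in> Linf_fun K" "c = ?cl h" by (auto simp: carrier_Linf)
    with that(2) have "(h, f) \<in> ae_rel K" by simp
    then have "c = ?cl f" "f \<in> Linf_fun K"
      unfolding h(2) using equiv_class_eq[OF equiv_ae_rel] by (auto simp: ae_rel_def)
    then show ?thesis using Psi_J_fun_derivative_AE[OF K] by (simp add: J)
  qed
  show ?thesis using J_X Psi_C0 lie range deriv by blast
qed

end
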